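(* Let $\Phi:\mathbb{M}_n\to\mathbb{M}_{n'}$ be a positive linear map. Let $A\in\mathbb{M}_n^+$ be given with the spectral decomposition $A=\sum_{k=1}^m a_kP_k$, where $a_1>a_2>\dots>a_m>0$. Define $$\mathcal{M}_1:=\mathrm{ran}\,\Phi(P_1),\qquad \mathcal{M}_k:=\mathrm{ran}\,\Phi(P_1+\dots+P_k)\ominus\mathrm{ran}\,\Phi(P_1+\dots+P_{k-1}),\quad 2\le k\le m.$$ Then $$\lim_{p\to\infty}\Phi(A^p)^{1/p}=\sum_{k=1}^m a_kP_{\mathcal{M}_k}.$$
   Context: $\mathbb{M}_n$ is the algebra of $n\times n$ complex matrices and $\mathbb{M}_n^+$ the set of positive semidefinite matrices in $\mathbb{M}_n$. A linear map $\Phi:\mathbb{M}_n\to\mathbb{M}_{n'}$ is positive if $\Phi(X)\in\mathbb{M}_{n'}^+$ for all $X\in\mathbb{M}_n^+$. In the spectral decomposition, $a_1,\dots,a_m$ are the distinct positive eigenvalues of $A$ and $P_k$ is the orthogonal projection onto the eigenspace of $a_k$ (the $P_k$ sum to the support projection of $A$, not necessarily to $I$). $\mathrm{ran}\,X$ is the range of $X$; for subspaces $\mathcal{S}\subset\mathcal{R}$, $\mathcal{R}\ominus\mathcal{S}$ is the orthogonal complement of $\mathcal{S}$ in $\mathcal{R}$; $P_{\mathcal{M}}$ is the orthogonal projection onto the subspace $\mathcal{M}$. Powers of positive semidefinite matrices are defined by functional calculus (with $0^p=0$ for $p>0$). The limit is over real $p\to\infty$. *)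

theory Defs
  imports "HOL-Analysis.Analysis"
begin

(* HOL-Analysis only has the real inner product on complex^'n; this is the complex one,
   linear in the first argument. *)
definition cinner :: "complex^'n \<Rightarrow> complex^'n \<Rightarrow> complex" where
  "cinner x y = (\<Sum>i\<in>UNIV. x $ i * cnj (y $ i))"

definition conj_transpose :: "complex^'n^'m \<Rightarrow> complex^'m^'n" where
  "conj_transpose A = transpose (map_matrix cnj A)"

definition psd :: "complex^'n^'n \<Rightarrow> bool" where
  "psd A \<longleftrightarrow> conj_transpose A = A \<and> (\<forall>x. 0 \<le> Re (cinner (A *v x) x))"

(* Entrywise scaling by a complex number. On the type complex^'n^'m the library's *s takes
   scalars from complex^'n and *_R only real ones. *)
definition mscale :: "complex \<Rightarrow> complex^'n^'m \<Rightarrow> complex^'n^'m" where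
  "mscale c A = map_matrix (\<lambda>z. c * z) A"

(* Vector_Spaces.linear includes the vector-space axioms for both scalings, so without this
   fact the linearity condition below could be unsatisfiable. *)
lemma vector_space_mscale: "vector_space (mscale :: complex \<Rightarrow> complex^'n^'m \<Rightarrow> _)"
  by unfold_locales (simp_all add: mscale_def vec_eq_iff algebra_simps)

definition positive_linear_map :: "(complex^'n^'n \<Rightarrow> complex^'m^'m) \<Rightarrow> bool" where
  "positive_linear_map \<Phi> \<longleftrightarrow>
     Vector_Spaces.linear mscale mscale \<Phi> \<and> (\<forall>X. psd X \<longrightarrow> psd (\<Phi> X))"

definition mat_range :: "complex^'n^'m \<Rightarrow> (complex^'m) set" where
  "mat_range X = range (\<lambda>v. X *v v)"

definition orth_minus :: "(complex^'n) set \<Rightarrow> (complex^'n) set \<Rightarrow> (complex^'n) set"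
    (infixl "\<ominus>" 65) where
  "R \<ominus> S = {x \<in> R. \<forall>y\<in>S. cinner x y = 0}"

(* Meaningful for complex-linear subspaces S, where such a matrix exists and is unique. *)
definition orth_proj :: "(complex^'n) set \<Rightarrow> complex^'n^'n" where
  "orth_proj S = (THE P. \<forall>x. P *v x \<in> S \<and> (\<forall>y\<in>S. cinner (x - P *v x) y = 0))"

definition eigenspace :: "complex^'n^'n \<Rightarrow> real \<Rightarrow> (complex^'n) set" where
  "eigenspace A c = {v. A *v v = complex_of_real c *s v}"

(* Real eigenvalues only; for a Hermitian matrix these are all of them. *)
definition eigenvalues :: "complex^'n^'n \<Rightarrow> real set" where
  "eigenvalues A = {c. \<exists>v. v \<noteq> 0 \<and> v \<in> eigenspace A c}"

(* Meaningful for Hermitian matrices. *)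
definition fun_calc :: "(real \<Rightarrow> real) \<Rightarrow> complex^'n^'n \<Rightarrow> complex^'n^'n" where
  "fun_calc f A = (\<Sum>c\<in>eigenvalues A. f c *\<^sub>R orth_proj (eigenspace A c))"

(* For positive semidefinite matrices; 0 powr p = 0, so the kernel contributes nothing. *)
definition mat_powr :: "complex^'n^'n \<Rightarrow> real \<Rightarrow> complex^'n^'n" where
  "mat_powr A p = fun_calc (\<lambda>t. t powr p) A"

end

theory Submission
  imports Defs "HOL-Real_Asymp.Real_Asymp"
begin

text \<open>
  Put \<open>Q\<^sub>k = \<Phi> P\<^sub>k\<close>. By the functional calculus and linearity \<open>\<Phi>(A\<^sup>p)\<close> is the power sum
  \<open>B\<^sub>p = \<Sum>\<^sub>k a\<^sub>k\<^sup>p Q\<^sub>k\<close> of positive semidefinite matrices. Let \<open>R\<^sub>k\<close> be the range of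
  \<open>Q\<^sub>1 + \<dots> + Q\<^sub>k\<close>. Then \<open>R\<^sub>k\<close> is the orthogonal sum of \<open>M\<^sub>1, \<dots>, M\<^sub>k\<close>, and two elementary bounds
  hold with constants independent of \<open>p\<close>. First,
  \<open>B\<^sub>p \<ge> a\<^sub>k\<^sup>p (Q\<^sub>1 + \<dots> + Q\<^sub>k)\<close> dominates a multiple of \<open>a\<^sub>k\<^sup>p\<close> times the projection onto \<open>M\<^sub>k\<close>,
  since a positive semidefinite matrix is bounded below on its range
  (\<open>psd_ge_range_projection\<close>). Second, on \<open>M\<^sub>k\<close> the matrices \<open>Q\<^sub>j\<close> with \<open>j < k\<close> vanish, so the form of
  \<open>B\<^sub>p\<close> is at most a multiple of \<open>a\<^sub>k\<^sup>p\<close> there.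

  These bounds locate the eigenvectors of \<open>B\<^sub>p\<close>. Let \<open>v\<close> be a unit eigenvector with eigenvalue
  \<open>\<mu>\<^sup>p\<close> and \<open>w\<close> its component in \<open>M\<^sub>k\<close>. If \<open>\<mu> < a\<^sub>k\<close>, the first bound at \<open>v\<close> shows that \<open>w\<close> is of order
  \<open>(\<mu> / a\<^sub>k)\<^bsup>p/2\<^esup>\<close>; if \<open>\<mu> > a\<^sub>k\<close>, Cauchy-Schwarz for the form of \<open>B\<^sub>p\<close> and the second bound at \<open>w\<close> show
  that it is of order \<open>(a\<^sub>k / \<mu>)\<^bsup>p/2\<^esup>\<close>. Either way \<open>\<bar>\<mu> - a\<^sub>k\<bar> \<parallel>w\<parallel> = O(1/p)\<close> uniformly in \<open>\<mu>\<close>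
  (\<open>eigenvector_component_bound\<close>). The component of \<open>v\<close> orthogonal to \<open>R\<^sub>m\<close> lies
  in the kernel of \<open>B\<^sub>p\<close>, so it is zero unless \<open>\<mu> = 0\<close>. The \<open>p\<close>-th root of \<open>B\<^sub>p\<close> multiplies \<open>v\<close> by \<open>\<mu>\<close>, whereas the
  claimed limit multiplies each component by its \<open>a\<^sub>k\<close>; so the two matrices differ by \<open>O(1/p)\<close> on
  every unit eigenvector of \<open>B\<^sub>p\<close>, and by the spectral theorem (\<open>spectral_resolution\<close>) on every unit
  vector.

  For complex subspaces orthogonality for the complex inner product is the same as orthogonality
  for its real part, the inner product of the underlying real Euclidean space. All
  geometric arguments therefore use the real one.
\<close>

section \<open>The complex inner product and its real part\<close>

lemma Re_cinner: "Re (cinner x y) = x \<bullet> y"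
  by (simp add: cinner_def inner_vec_def inner_complex_def)

lemma cinner_scale_right: "cinner x (c *s y) = cnj c * cinner x y"
  by (simp add: cinner_def sum_distrib_left mult_ac)

lemma of_real_scale: "complex_of_real r *s x = r *\<^sub>R x"
  by (simp add: vec_eq_iff complex_eq_iff)

lemma csubspace_imp_subspace:
  fixes S :: "(complex^'n) set"
  assumes "vec.subspace S"
  shows "subspace S"
  using assms unfolding vec.subspace_def subspace_def
  by (metis of_real_scale)

text \<open>
  Multiplying \<open>y\<close> by \<open>\<i>\<close>, which stays in \<open>S\<close>, turns the imaginary part of the complex inner product
  into a real part.
\<close>
lemma cinner_zero_iff_inner_zero:
  assumes "vec.subspace S"
  shows "(\<forall>y\<in>S. cinner x y = 0) \<longleftrightarrow> (\<forall>y\<in>S. x \<bullet> y = 0)"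
proof
  assume "\<forall>y\<in>S. cinner x y = 0"
  then show "\<forall>y\<in>S. x \<bullet> y = 0"
    by (simp flip: Re_cinner)
next
  assume 0: "\<forall>y\<in>S. x \<bullet> y = 0"
  show "\<forall>y\<in>S. cinner x y = 0"
  proof
    fix y assume y: "y \<in> S"
    then have "\<i> *s y \<in> S"
      using assms by (rule vec.subspace_scale[rotated])
    then have "Re (cinner x (\<i> *s y)) = 0"
      using 0 by (simp add: Re_cinner)
    moreover have "Re (cinner x y) = 0"
      using 0 y by (simp add: Re_cinner)
    ultimately show "cinner x y = 0"
      by (simp add: cinner_scale_right complex_eq_iff)
  qed
qed

lemma orth_minus_eq:
  assumes "vec.subspace S"
  shows "R \<ominus> S = {x \<in> R. \<forall>y\<in>S. x \<bullet> y = 0}"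
  using cinner_zero_iff_inner_zero[OF assms] unfolding orth_minus_def by blast

lemma csubspace_orth_minus:
  fixes R S :: "(complex^'n) set"
  assumes "vec.subspace R"
  shows "vec.subspace (R \<ominus> S)"
proof -
  have "cinner (x + y) z = cinner x z + cinner y z" "cinner (c *s x) z = c * cinner x z"
    for x y z :: "complex^'n" and c
    by (simp_all add: cinner_def sum.distrib sum_distrib_left algebra_simps)
  moreover have "cinner 0 z = 0" for z :: "complex^'n"
    by (simp add: cinner_def)
  ultimately show ?thesis
    using assms unfolding vec.subspace_def orth_minus_def by simp
qed

lemma csubspace_mat_range: "vec.subspace (mat_range (X :: complex^'n^'m))"
  unfolding mat_range_def
  by (rule vec.linear_subspace_image[OF matrix_vector_mul_linear_gen vec.subspace_UNIV])

lemma csubspace_eigenspace: "vec.subspace (eigenspace A c)"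
  unfolding vec.subspace_def eigenspace_def
  by (auto simp: matrix_vector_right_distrib vector_scalar_commute vector_add_ldistrib
      vector_smult_assoc mult.commute)

lemma linear_mat: "linear ((*v) (A :: complex^'n^'m))"
  using bounded_linear.linear[OF matrix_vector_mul_bounded_linear] .

lemma scaleR_mult_vec: "(r *\<^sub>R A) *v x = r *\<^sub>R (A *v x)" for A :: "complex^'n^'m"
  by (simp add: vec_eq_iff matrix_vector_mult_def scaleR_sum_right)

lemma sum_mult_vec: "(\<Sum>i\<in>I. F i) *v x = (\<Sum>i\<in>I. F i *v x)" for F :: "'i \<Rightarrow> complex^'n^'m"
  by (induction I rule: infinite_finite_induct) (simp_all add: matrix_vector_mult_add_rdistrib)

lemma matrix_tendstoI:
  fixes F :: "'a \<Rightarrow> complex^'n^'m"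
  assumes "\<And>x. ((\<lambda>p. F p *v x) \<longlongrightarrow> L *v x) net"
  shows "(F \<longlongrightarrow> L) net"
proof (intro vec_tendstoI)
  fix i j
  have entry: "(X *v axis j 1) $ i = X $ i $ j" for X :: "complex^'n^'m"
    by (simp add: matrix_vector_mult_def axis_def if_distrib cong: if_cong)
  show "((\<lambda>p. F p $ i $ j) \<longlongrightarrow> L $ i $ j) net"
    using tendsto_vec_nth[OF assms[of "axis j 1"], of i] by (simp add: entry)
qed

section \<open>Hermitian and positive semidefinite matrices\<close>

lemma conj_transpose_inner: "(A *v x) \<bullet> y = x \<bullet> (conj_transpose A *v y)"
proof -
  have "cinner (A *v x) y = cinner x (conj_transpose A *v y)"
    unfolding cinner_def conj_transpose_def matrix_vector_mult_def transpose_def map_matrix_def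
    by (simp add: sum_distrib_left sum_distrib_right mult_ac) (rule sum.swap)
  then show ?thesis
    by (simp flip: Re_cinner)
qed

lemma hermitian_iff:
  "conj_transpose A = A \<longleftrightarrow> (\<forall>x y. (A *v x) \<bullet> y = x \<bullet> (A *v y))"
proof
  assume "conj_transpose A = A"
  then show "\<forall>x y. (A *v x) \<bullet> y = x \<bullet> (A *v y)"
    using conj_transpose_inner[of A] by simp
next
  assume "\<forall>x y. (A *v x) \<bullet> y = x \<bullet> (A *v y)"
  then have "x \<bullet> (conj_transpose A *v y) = x \<bullet> (A *v y)" for x y
    by (simp flip: conj_transpose_inner)
  then show "conj_transpose A = A"
    by (metis matrix_eq vector_eq_ldot)
qed

lemma psd_iff:
  "psd A \<longleftrightarrow> (\<forall>x y. (A *v x) \<bullet> y = x \<bullet> (A *v y)) \<and> (\<forall>x. 0 \<le> (A *v x) \<bullet> x)"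
  by (simp add: psd_def hermitian_iff Re_cinner)

lemma psd_sym: "psd A \<Longrightarrow> (A *v x) \<bullet> y = x \<bullet> (A *v y)"
  by (simp add: psd_iff)

lemma psd_nonneg: "psd A \<Longrightarrow> 0 \<le> (A *v x) \<bullet> x"
  unfolding psd_iff by blast

lemma psd_sum:
  assumes "\<And>i. i \<in> I \<Longrightarrow> psd (F i)"
  shows "psd (\<Sum>i\<in>I. F i)"
  unfolding psd_iff sum_mult_vec inner_sum_left inner_sum_right
  using assms by (auto intro!: sum_nonneg sum.cong psd_sym psd_nonneg)

lemma psd_scaleR: "psd A \<Longrightarrow> 0 \<le> r \<Longrightarrow> psd (r *\<^sub>R A)"
  unfolding psd_iff[of "r *\<^sub>R A"] scaleR_mult_vec inner_scaleR_left inner_scaleR_right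
  by (simp add: psd_sym) (simp add: psd_nonneg flip: psd_sym)

text \<open>
  The discriminant of the nonnegative quadratic \<open>t \<mapsto> f (x + t y) \<bullet> (x + t y)\<close> is nonpositive.
  Nonnegativity is asked for on a subspace \<open>W\<close> because the spectral theorem applies this to \<open>\<lambda>x - A x\<close> on an invariant subspace.
\<close>
lemma Cauchy_Schwarz_form:
  fixes f :: "'a::real_inner \<Rightarrow> 'a"
  assumes f: "linear f" and sym: "\<And>x y. f x \<bullet> y = x \<bullet> f y"
    and W: "subspace W" and nonneg: "\<And>z. z \<in> W \<Longrightarrow> 0 \<le> f z \<bullet> z"
    and x: "x \<in> W" and y: "y \<in> W"
  shows "(f x \<bullet> y)\<^sup>2 \<le> (f x \<bullet> x) * (f y \<bullet> y)"
proof -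
  define a b c where "a = f x \<bullet> x" and "b = f x \<bullet> y" and "c = f y \<bullet> y"
  have q: "0 \<le> s\<^sup>2 * a + 2 * s * t * b + t\<^sup>2 * c" for s t
  proof -
    have "s *\<^sub>R x + t *\<^sub>R y \<in> W"
      using W x y by (simp add: subspace_add subspace_scale)
    from nonneg[OF this] show ?thesis
      using sym[of y x]
      by (simp add: linear_add[OF f] linear_scale[OF f] inner_add_left inner_add_right
          a_def b_def c_def power2_eq_square algebra_simps inner_commute)
  qed
  show ?thesis
  proof (cases "c = 0")
    case True
    have "b = 0"
    proof (rule ccontr)
      assume "b \<noteq> 0"
      (* This value of t makes the quadratic equal to -1. *)
      with q[of 1 "- (a + 1) / (2 * b)"] True show False
        by (simp add: field_simps)
    qed
    then show ?thesis
      using True by (simp add: b_def c_def)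
  next
    case False
    with nonneg[OF y] have "0 < c"
      by (simp add: c_def)
    moreover from q[of c "- b"] have "0 \<le> c * (a * c - b\<^sup>2)"
      by (simp add: power2_eq_square algebra_simps)
    ultimately show ?thesis
      by (simp add: a_def b_def c_def zero_le_mult_iff)
  qed
qed

lemma Cauchy_Schwarz_psd:
  assumes "psd A"
  shows "((A *v x) \<bullet> y)\<^sup>2 \<le> ((A *v x) \<bullet> x) * ((A *v y) \<bullet> y)"
  using assms by (intro Cauchy_Schwarz_form[OF linear_mat, of A UNIV]) (auto simp: psd_iff)

lemma mat_bound:
  fixes A :: "complex^'n^'m"
  obtains K where "K > 0" "\<And>x. norm (A *v x) \<le> K * norm x"
  using bounded_linear.pos_bounded[OF matrix_vector_mul_bounded_linear, of A]
  by (auto simp: mult.commute)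

lemma mat_form_bound:
  fixes A :: "complex^'n^'n"
  obtains K where "K > 0" "\<And>x. (A *v x) \<bullet> x \<le> K * (norm x)\<^sup>2"
proof -
  obtain K where K: "K > 0" "\<And>x. norm (A *v x) \<le> K * norm x"
    by (rule mat_bound[of A]) blast
  have "(A *v x) \<bullet> x \<le> K * (norm x)\<^sup>2" for x
  proof -
    have "(A *v x) \<bullet> x \<le> norm (A *v x) * norm x"
      by (rule norm_cauchy_schwarz)
    also have "\<dots> \<le> K * norm x * norm x"
      by (intro mult_right_mono K) simp
    finally show ?thesis
      by (simp add: power2_eq_square mult.assoc)
  qed
  with K(1) show ?thesis
    by (rule that)
qed

text \<open>Cauchy-Schwarz for the form of \<open>A\<close>, applied to \<open>x\<close> and \<open>A x\<close>.\<close>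
lemma psd_norm_square_le:
  fixes A :: "complex^'n^'n"
  assumes "psd A"
  obtains K where "K > 0" "\<And>x. (norm (A *v x))\<^sup>2 \<le> K * ((A *v x) \<bullet> x)"
proof -
  obtain K where K: "K > 0" "\<And>x. (A *v x) \<bullet> x \<le> K * (norm x)\<^sup>2"
    by (rule mat_form_bound[of A]) blast
  have "(norm (A *v x))\<^sup>2 \<le> K * ((A *v x) \<bullet> x)" for x
  proof (cases "A *v x = 0")
    case False
    have "((norm (A *v x))\<^sup>2)\<^sup>2 \<le> ((A *v x) \<bullet> x) * ((A *v (A *v x)) \<bullet> (A *v x))"
      using Cauchy_Schwarz_psd[OF assms, of x "A *v x"] by (simp add: dot_square_norm)
    also have "\<dots> \<le> ((A *v x) \<bullet> x) * (K * (norm (A *v x))\<^sup>2)"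
      by (intro mult_left_mono K psd_nonneg assms)
    finally have "(norm (A *v x))\<^sup>2 * (norm (A *v x))\<^sup>2
        \<le> (K * ((A *v x) \<bullet> x)) * (norm (A *v x))\<^sup>2"
      by (simp add: power2_eq_square mult_ac)
    then show ?thesis
      by (rule mult_right_le_imp_le) (use False in simp)
  qed simp
  with K(1) show ?thesis
    by (rule that)
qed

lemma psd_kernel: "psd A \<Longrightarrow> (A *v x) \<bullet> x = 0 \<Longrightarrow> A *v x = 0"
  using psd_norm_square_le[of A] by (metis mult_zero_right norm_eq_zero power2_less_eq_zero_iff)

section \<open>Orthogonal projections\<close>

lemma orth_decomposition_unique:
  fixes x :: "'a::real_inner"
  assumes "subspace S" "u \<in> S" "v \<in> S" "\<forall>y\<in>S. (x - u) \<bullet> y = 0" "\<forall>y\<in>S. (x - v) \<bullet> y = 0"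
  shows "u = v"
proof -
  have "u - v \<in> S"
    using assms by (simp add: subspace_diff)
  with assms(4,5) have "(x - u) \<bullet> (u - v) = 0" "(x - v) \<bullet> (u - v) = 0"
    by simp_all
  then have "(u - v) \<bullet> (u - v) = 0"
    by (simp add: inner_diff_left)
  then show ?thesis
    by simp
qed

lemma orth_proj_exists:
  fixes S :: "(complex^'n) set"
  assumes S: "vec.subspace S"
  shows "\<exists>P :: complex^'n^'n. \<forall>x. P *v x \<in> S \<and> (\<forall>y\<in>S. (x - P *v x) \<bullet> y = 0)"
proof -
  have subS: "subspace S"
    by (rule csubspace_imp_subspace[OF S])
  have "\<exists>u\<in>S. \<forall>y\<in>S. (x - u) \<bullet> y = 0" for x
  proof -
    obtain u z where "u \<in> span S" "\<And>w. w \<in> span S \<Longrightarrow> orthogonal z w" "x = u + z"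
      using orthogonal_subspace_decomp_exists[of S x] by metis
    then have "u \<in> S" "\<forall>y\<in>S. (x - u) \<bullet> y = 0"
      using subS by (simp_all add: span_eq_iff[THEN iffD2] orthogonal_def)
    then show ?thesis
      by blast
  qed
  then obtain f where f: "\<And>x. f x \<in> S" "\<And>x. \<forall>y\<in>S. (x - f x) \<bullet> y = 0"
    by metis
  have "Vector_Spaces.linear (*s) (*s) f"
  proof (unfold_locales)
    fix x y
    show "f (x + y) = f x + f y"
    proof (rule orth_decomposition_unique[OF subS, of _ _ "x + y"])
      show "\<forall>z\<in>S. (x + y - (f x + f y)) \<bullet> z = 0"
        using f(2)[of x] f(2)[of y] by (simp add: inner_diff_left inner_add_left)
    qed (use f subS in \<open>simp_all add: subspace_add\<close>)
  next
    fix c x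
    have "\<forall>y\<in>S. cinner (x - f x) y = 0"
      using f(2) cinner_zero_iff_inner_zero[OF S] by blast
    then have "\<forall>y\<in>S. cinner (c *s x - c *s f x) y = 0"
      by (simp add: cinner_def right_diff_distrib[symmetric] sum_distrib_left[symmetric] mult.assoc)
    then have "\<forall>y\<in>S. (c *s x - c *s f x) \<bullet> y = 0"
      using cinner_zero_iff_inner_zero[OF S] by blast
    then show "f (c *s x) = c *s f x"
      by (intro orth_decomposition_unique[OF subS, of _ _ "c *s x"] f vec.subspace_scale[OF S])
  qed
  then have "matrix f *v x = f x" for x
    by (rule matrix_works)
  with f show ?thesis
    by metis
qed

lemma
  assumes S: "vec.subspace S"
  shows orth_proj_in: "orth_proj S *v x \<in> S"
    and orth_proj_perp: "y \<in> S \<Longrightarrow> (x - orth_proj S *v x) \<bullet> y = 0"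
proof -
  have subS: "subspace S"
    by (rule csubspace_imp_subspace[OF S])
  have def: "orth_proj S = (THE P. \<forall>x. P *v x \<in> S \<and> (\<forall>y\<in>S. (x - P *v x) \<bullet> y = 0))"
    unfolding orth_proj_def using cinner_zero_iff_inner_zero[OF S] by simp
  have "\<exists>!P. \<forall>x. P *v x \<in> S \<and> (\<forall>y\<in>S. (x - P *v x) \<bullet> y = 0)"
  proof (rule ex_ex1I[OF orth_proj_exists[OF S]])
    fix P Q
    assume "\<forall>x. P *v x \<in> S \<and> (\<forall>y\<in>S. (x - P *v x) \<bullet> y = 0)"
      "\<forall>x. Q *v x \<in> S \<and> (\<forall>y\<in>S. (x - Q *v x) \<bullet> y = 0)"
    then have "P *v x = Q *v x" for x
      by (intro orth_decomposition_unique[OF subS]) auto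
    then show "P = Q"
      by (simp add: matrix_eq)
  qed
  from theI'[OF this] show "orth_proj S *v x \<in> S"
    and "y \<in> S \<Longrightarrow> (x - orth_proj S *v x) \<bullet> y = 0"
    unfolding def by blast+
qed

lemma orth_proj_eqI:
  assumes "vec.subspace S" "u \<in> S" "\<And>y. y \<in> S \<Longrightarrow> (x - u) \<bullet> y = 0"
  shows "orth_proj S *v x = u"
  using assms
  by (intro orth_decomposition_unique[OF csubspace_imp_subspace[OF assms(1)]])
    (auto simp: orth_proj_in orth_proj_perp)

lemma orth_proj_ident: "vec.subspace S \<Longrightarrow> x \<in> S \<Longrightarrow> orth_proj S *v x = x"
  by (rule orth_proj_eqI) simp_all

lemma orth_proj_zero:
  "vec.subspace S \<Longrightarrow> (\<And>y. y \<in> S \<Longrightarrow> x \<bullet> y = 0) \<Longrightarrow> orth_proj S *v x = 0"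
  by (rule orth_proj_eqI) (simp_all add: vec.subspace_0)

lemma orth_proj_inner_self:
  assumes "vec.subspace S"
  shows "x \<bullet> (orth_proj S *v x) = (norm (orth_proj S *v x))\<^sup>2"
  using orth_proj_perp[OF assms orth_proj_in[OF assms], of x x]
  by (simp add: inner_diff_left dot_square_norm)

lemma orth_proj_norm_le:
  assumes "vec.subspace S"
  shows "norm (orth_proj S *v x) \<le> norm x"
proof -
  let ?u = "orth_proj S *v x"
  have "norm ?u * norm ?u \<le> norm x * norm ?u"
    using norm_cauchy_schwarz[of x ?u] by (simp add: orth_proj_inner_self[OF assms] power2_eq_square)
  then show ?thesis
    by (cases "?u = 0") simp_all
qed

lemma orth_proj_norm_mono:
  assumes R: "vec.subspace R" and S: "vec.subspace S" and "S \<subseteq> R"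
  shows "norm (orth_proj S *v x) \<le> norm (orth_proj R *v x)"
proof -
  let ?u = "orth_proj R *v x" let ?v = "orth_proj S *v x"
  have v: "?v \<in> S"
    by (rule orth_proj_in[OF S])
  then have "(x - ?u) \<bullet> ?v = 0"
    using assms by (intro orth_proj_perp) auto
  then have "norm ?v * norm ?v = ?u \<bullet> ?v"
    using orth_proj_inner_self[OF S, of x] by (simp add: inner_diff_left power2_eq_square)
  also have "\<dots> \<le> norm ?u * norm ?v"
    by (rule norm_cauchy_schwarz)
  finally show ?thesis
    by (cases "?v = 0") simp_all
qed

lemma psd_orth_proj:
  assumes S: "vec.subspace S"
  shows "psd (orth_proj S)"
  unfolding psd_iff
proof (intro conjI allI)
  fix x y
  let ?P = "orth_proj S"
  have "(x - ?P *v x) \<bullet> (?P *v y) = 0" "(y - ?P *v y) \<bullet> (?P *v x) = 0"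
    by (intro orth_proj_perp orth_proj_in S)+
  then show "(?P *v x) \<bullet> y = x \<bullet> (?P *v y)"
    by (simp add: inner_diff_left) (simp add: inner_commute)
  show "0 \<le> (?P *v x) \<bullet> x"
    using orth_proj_inner_self[OF S, of x] by (simp add: inner_commute)
qed

lemma orth_proj_split:
  assumes R: "vec.subspace R" and S: "vec.subspace S" and "S \<subseteq> R"
  shows "orth_proj R = orth_proj S + orth_proj (R \<ominus> S)"
  unfolding matrix_eq
proof
  fix x
  let ?u = "orth_proj R *v x" let ?v = "orth_proj S *v x"
  have T: "vec.subspace (R \<ominus> S)"
    by (rule csubspace_orth_minus[OF R])
  have mem: "?u \<in> R" "?v \<in> S" "?v \<in> R"
    using assms by (auto intro: orth_proj_in)
  have "orth_proj (R \<ominus> S) *v x = ?u - ?v"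
  proof (rule orth_proj_eqI[OF T])
    have "(?u - ?v) \<bullet> y = 0" if "y \<in> S" for y
    proof -
      have "(x - ?u) \<bullet> y = 0" "(x - ?v) \<bullet> y = 0"
        using that assms by (auto intro: orth_proj_perp)
      then show ?thesis
        by (simp add: inner_diff_left)
    qed
    with mem show "?u - ?v \<in> R \<ominus> S"
      by (simp add: orth_minus_eq[OF S] vec.subspace_diff[OF R])
    fix y assume "y \<in> R \<ominus> S"
    then have y: "y \<in> R" "\<forall>z\<in>S. y \<bullet> z = 0"
      by (simp_all add: orth_minus_eq[OF S])
    then have "(x - ?u) \<bullet> y = 0" "y \<bullet> ?v = 0"
      using mem(2) by (blast intro: orth_proj_perp[OF R])+
    then show "(x - (?u - ?v)) \<bullet> y = 0"
      by (simp add: inner_diff_left inner_commute[of y])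
  qed
  then show "orth_proj R *v x = (orth_proj S + orth_proj (R \<ominus> S)) *v x"
    by (simp add: matrix_vector_mult_add_rdistrib)
qed

section \<open>The spectral theorem and the functional calculus\<close>

lemma mem_eigenspace: "x \<in> eigenspace A c \<longleftrightarrow> A *v x = c *\<^sub>R x"
  by (simp add: eigenspace_def of_real_scale)

lemma eigenspaces_orthogonal:
  assumes sym: "\<And>x y. (A *v x) \<bullet> y = x \<bullet> (A *v y)"
    and "x \<in> eigenspace A c" "y \<in> eigenspace A d" "c \<noteq> d"
  shows "x \<bullet> y = 0"
proof -
  have "c * (x \<bullet> y) = d * (x \<bullet> y)"
    using sym[of x y] assms(2,3) by (simp add: mem_eigenspace)
  with \<open>c \<noteq> d\<close> show ?thesis
    by simp
qed

text \<open>Eigenvectors for distinct eigenvalues are orthogonal, hence independent.\<close>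
lemma finite_eigenvalues:
  fixes A :: "complex^'n^'n"
  assumes sym: "\<And>x y. (A *v x) \<bullet> y = x \<bullet> (A *v y)"
  shows "finite (eigenvalues A) \<and> card (eigenvalues A) \<le> DIM(complex^'n)"
proof -
  have "\<forall>c\<in>eigenvalues A. \<exists>v. v \<noteq> 0 \<and> v \<in> eigenspace A c"
    by (simp add: eigenvalues_def)
  from bchoice[OF this]
  obtain f where f: "\<And>c. c \<in> eigenvalues A \<Longrightarrow> f c \<noteq> 0 \<and> f c \<in> eigenspace A c"
    by blast
  have orth: "f c \<bullet> f d = 0" if "c \<in> eigenvalues A" "d \<in> eigenvalues A" "c \<noteq> d" for c d
    using that f eigenspaces_orthogonal[OF sym] by blast
  then have inj: "inj_on f (eigenvalues A)"
    using f by (metis inj_onI inner_eq_zero_iff)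
  have "pairwise orthogonal (f ` eigenvalues A)"
    using orth unfolding pairwise_def orthogonal_def by blast
  moreover have "0 \<notin> f ` eigenvalues A"
    using f by force
  ultimately have "independent (f ` eigenvalues A)"
    by (rule pairwise_orthogonal_independent)
  from independent_bound[OF this] show ?thesis
    using inj by (simp add: card_image finite_image_iff)
qed

text \<open>
  A unit vector of \<open>W\<close> at which \<open>x \<bullet> A x\<close> attains its maximum \<open>\<lambda>\<close> is an eigenvector: the form of
  \<open>\<lambda> - A\<close> is nonnegative on \<open>W\<close> and vanishes there, so by Cauchy-Schwarz \<open>\<lambda> - A\<close> kills it.
\<close>
lemma eigenvector_in_invariant_subspace:
  fixes A :: "complex^'n^'n"
  assumes sym: "\<And>x y. (A *v x) \<bullet> y = x \<bullet> (A *v y)"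
    and W: "subspace W" and inv: "\<And>x. x \<in> W \<Longrightarrow> A *v x \<in> W" and w: "w \<in> W" "w \<noteq> 0"
  obtains x c where "x \<in> W" "x \<noteq> 0" "x \<in> eigenspace A c"
proof -
  let ?S = "sphere 0 1 \<inter> W"
  have "compact ?S"
    by (simp add: W closed_subspace compact_Int_closed)
  moreover have "(1 / norm w) *\<^sub>R w \<in> ?S"
    using w W by (simp add: subspace_scale)
  then have "?S \<noteq> {}"
    by blast
  moreover have "continuous_on ?S (\<lambda>x. x \<bullet> (A *v x))"
    by (intro continuous_intros)
  ultimately obtain x where x: "x \<in> ?S" and max: "\<And>y. y \<in> ?S \<Longrightarrow> y \<bullet> (A *v y) \<le> x \<bullet> (A *v x)"
    using continuous_attains_sup[of ?S "\<lambda>x. x \<bullet> (A *v x)"] by blast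
  define c where "c = x \<bullet> (A *v x)"
  define f where "f = (\<lambda>y. c *\<^sub>R y - A *v y)"
  have f: "linear f"
    unfolding f_def by (intro linear_compose_sub linear_compose_scale_right linear_ident linear_mat)
  have fsym: "f y \<bullet> z = y \<bullet> f z" for y z
    by (simp add: f_def inner_diff_left inner_diff_right sym)
  have nonneg: "0 \<le> f y \<bullet> y" if "y \<in> W" for y
  proof (cases "y = 0")
    case False
    let ?u = "(1 / norm y) *\<^sub>R y"
    have "?u \<in> ?S"
      using that False W by (simp add: subspace_scale)
    then have "?u \<bullet> (A *v ?u) \<le> c"
      unfolding c_def by (rule max)
    then have "(y \<bullet> (A *v y)) / (norm y)\<^sup>2 \<le> c"
      by (simp add: linear_scale[OF linear_mat] power2_eq_square divide_simps)
    then have "y \<bullet> (A *v y) \<le> c * (norm y)\<^sup>2"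
      using False by (simp add: field_simps)
    then show ?thesis
      by (simp add: f_def inner_diff_left dot_square_norm sym)
  qed (simp add: f_def)
  have xW: "x \<in> W" and nx: "norm x = 1"
    using x by simp_all
  have "f x \<in> W"
    unfolding f_def using xW W inv by (simp add: subspace_diff subspace_scale)
  then have "(f x \<bullet> f x)\<^sup>2 \<le> (f x \<bullet> x) * (f (f x) \<bullet> f x)"
    using xW by (intro Cauchy_Schwarz_form[OF f fsym W nonneg])
  moreover have "f x \<bullet> x = 0"
    using nx by (simp add: f_def c_def inner_diff_left dot_square_norm sym)
  ultimately have "f x = 0"
    by simp
  then have "x \<in> eigenspace A c"
    by (simp add: f_def mem_eigenspace)
  with xW nx show ?thesis
    by (intro that[of x c]) auto
qed

text \<open>
  The part of \<open>x\<close> not captured by the eigenspaces lies in their common orthogonal complement,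
  which is invariant and contains no eigenvector.
\<close>
lemma spectral_resolution:
  fixes A :: "complex^'n^'n"
  assumes sym: "\<And>x y. (A *v x) \<bullet> y = x \<bullet> (A *v y)"
  shows "(\<Sum>c\<in>eigenvalues A. orth_proj (eigenspace A c) *v x) = x"
proof -
  let ?E = "\<lambda>c. orth_proj (eigenspace A c)"
  define W where "W = {z. \<forall>c. \<forall>y\<in>eigenspace A c. z \<bullet> y = 0}"
  have W: "subspace W"
    unfolding W_def subspace_def by (simp add: inner_add_left)
  have inv: "A *v z \<in> W" if z: "z \<in> W" for z
    unfolding W_def
  proof (intro CollectI allI ballI)
    fix c y
    assume y: "y \<in> eigenspace A c"
    with z have "z \<bullet> y = 0"
      by (simp add: W_def)
    moreover have "(A *v z) \<bullet> y = c * (z \<bullet> y)"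
      using sym[of z y] y by (simp add: mem_eigenspace)
    ultimately show "(A *v z) \<bullet> y = 0"
      by simp
  qed
  define r where "r = x - (\<Sum>c\<in>eigenvalues A. ?E c *v x)"
  have "r \<in> W"
    unfolding W_def
  proof (intro CollectI allI ballI)
    fix d y
    assume y: "y \<in> eigenspace A d"
    show "r \<bullet> y = 0"
    proof (cases "y = 0")
      case False
      with y have d: "d \<in> eigenvalues A"
        by (auto simp: eigenvalues_def)
      have "(?E c *v x) \<bullet> y = 0" if "c \<noteq> d" for c
        by (rule eigenspaces_orthogonal[OF sym orth_proj_in[OF csubspace_eigenspace] y that])
      then have "(\<Sum>c\<in>eigenvalues A - {d}. (?E c *v x) \<bullet> y) = 0"
        by (intro sum.neutral) auto
      then have "(\<Sum>c\<in>eigenvalues A. (?E c *v x) \<bullet> y) = (?E d *v x) \<bullet> y"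
        using finite_eigenvalues[OF sym] d by (simp add: sum.remove[OF _ d])
      then have "r \<bullet> y = (x - ?E d *v x) \<bullet> y"
        by (simp add: r_def inner_diff_left inner_sum_left)
      then show ?thesis
        using orth_proj_perp[OF csubspace_eigenspace y] by simp
    qed simp
  qed
  have "r = 0"
  proof (rule ccontr)
    assume "r \<noteq> 0"
    then obtain z c where "z \<in> W" "z \<noteq> 0" "z \<in> eigenspace A c"
      using eigenvector_in_invariant_subspace[OF sym W inv \<open>r \<in> W\<close>] by blast
    then have "z \<bullet> z = 0"
      unfolding W_def by blast
    with \<open>z \<noteq> 0\<close> show False
      by simp
  qed
  then show ?thesis
    by (simp add: r_def)
qed

lemma fun_calc_eigenvector:
  assumes sym: "\<And>x y. (A *v x) \<bullet> y = x \<bullet> (A *v y)" and x: "x \<in> eigenspace A c"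
  shows "fun_calc f A *v x = f c *\<^sub>R x"
proof (cases "x = 0")
  case False
  with x have c: "c \<in> eigenvalues A"
    by (auto simp: eigenvalues_def)
  have "orth_proj (eigenspace A d) *v x = (if d = c then x else 0)" for d
    using x eigenspaces_orthogonal[OF sym x]
    by (auto intro: orth_proj_ident orth_proj_zero csubspace_eigenspace)
  then have "fun_calc f A *v x = (\<Sum>d\<in>eigenvalues A. if d = c then f d *\<^sub>R x else 0)"
    unfolding fun_calc_def sum_mult_vec scaleR_mult_vec by (intro sum.cong) simp_all
  then show ?thesis
    using c finite_eigenvalues[OF sym] by (simp add: sum.delta)
qed simp

lemma psd_eigenvalue_nonneg:
  assumes "psd A" "c \<in> eigenvalues A"
  shows "0 \<le> c"
proof -
  obtain v where v: "v \<noteq> 0" "A *v v = c *\<^sub>R v"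
    using assms(2) by (auto simp: eigenvalues_def mem_eigenspace)
  then have "0 \<le> c * (v \<bullet> v)"
    using psd_nonneg[OF assms(1), of v] by simp
  moreover have "0 < v \<bullet> v"
    using v(1) by simp
  ultimately show ?thesis
    by (simp add: zero_le_mult_iff del: inner_gt_zero_iff)
qed

text \<open>
  By the spectral theorem a bound on the eigenvectors of \<open>B\<close> becomes a bound on all vectors, at
  the cost of the number of eigenvalues.
\<close>
lemma norm_le_of_eigenvectors:
  fixes B X :: "complex^'n^'n" and \<delta> :: real
  assumes B: "psd B" and \<delta>: "0 \<le> \<delta>"
    and bound: "\<And>c v. 0 \<le> c \<Longrightarrow> B *v v = c *\<^sub>R v \<Longrightarrow> norm (X *v v) \<le> \<delta> * norm v"
  shows "norm (X *v x) \<le> DIM(complex^'n) * \<delta> * norm x"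
proof -
  let ?E = "\<lambda>c. orth_proj (eigenspace B c)"
  have "norm (X *v x) = norm (\<Sum>c\<in>eigenvalues B. X *v (?E c *v x))"
    by (simp add: spectral_resolution psd_sym[OF B] flip: linear_sum[OF linear_mat])
  also have "\<dots> \<le> (\<Sum>c\<in>eigenvalues B. \<delta> * norm x)"
  proof (rule sum_norm_le)
    fix c assume c: "c \<in> eigenvalues B"
    have "?E c *v x \<in> eigenspace B c"
      by (rule orth_proj_in[OF csubspace_eigenspace])
    then have "norm (X *v (?E c *v x)) \<le> \<delta> * norm (?E c *v x)"
      using psd_eigenvalue_nonneg[OF B c] by (intro bound[of c]) (simp_all add: mem_eigenspace)
    also have "\<dots> \<le> \<delta> * norm x"
      by (intro mult_left_mono orth_proj_norm_le csubspace_eigenspace \<delta>)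
    finally show "norm (X *v (?E c *v x)) \<le> \<delta> * norm x" .
  qed
  also have "\<dots> = card (eigenvalues B) * (\<delta> * norm x)"
    by simp
  also have "\<dots> \<le> DIM(complex^'n) * (\<delta> * norm x)"
    using finite_eigenvalues[of B] psd_sym[OF B] \<delta>
    by (intro mult_right_mono) (simp_all del: DIM_cart)
  finally show ?thesis
    by (simp add: mult.assoc)
qed

section \<open>Ranges of positive semidefinite matrices\<close>

lemma perp_mat_range_iff:
  assumes "psd A"
  shows "(\<forall>y\<in>mat_range A. x \<bullet> y = 0) \<longleftrightarrow> A *v x = 0"
proof -
  have "(\<forall>y\<in>mat_range A. x \<bullet> y = 0) \<longleftrightarrow> (\<forall>z. (A *v x) \<bullet> z = 0)"
    by (simp add: mat_range_def psd_sym[OF assms])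
  also have "\<dots> \<longleftrightarrow> A *v x = 0"
    by (metis inner_eq_zero_iff inner_zero_left)
  finally show ?thesis .
qed

lemma mult_orth_proj_mat_range:
  assumes "psd A"
  shows "A *v (orth_proj (mat_range A) *v x) = A *v x"
proof -
  have "A *v (x - orth_proj (mat_range A) *v x) = 0"
    using orth_proj_perp[OF csubspace_mat_range] by (subst perp_mat_range_iff[OF assms, symmetric]) blast
  then show ?thesis
    by (simp add: linear_diff[OF linear_mat])
qed

text \<open>
  For Hermitian matrices the range is the orthogonal complement of the kernel, so a
  smaller kernel means a larger range.
\<close>
lemma mat_range_mono_of_kernel:
  assumes "psd A" "psd B" and ker: "\<And>x. B *v x = 0 \<Longrightarrow> A *v x = 0"
  shows "mat_range A \<subseteq> mat_range B"
proof
  fix y assume y: "y \<in> mat_range A"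
  let ?P = "orth_proj (mat_range B)"
  have "\<forall>z\<in>mat_range B. (y - ?P *v y) \<bullet> z = 0"
    by (blast intro: orth_proj_perp[OF csubspace_mat_range])
  then have "B *v (y - ?P *v y) = 0"
    by (simp add: perp_mat_range_iff[OF assms(2)])
  then have "A *v (y - ?P *v y) = 0"
    by (rule ker)
  with y have "(y - ?P *v y) \<bullet> y = 0"
    by (simp flip: perp_mat_range_iff[OF assms(1)])
  moreover have "(y - ?P *v y) \<bullet> (?P *v y) = 0"
    by (intro orth_proj_perp orth_proj_in csubspace_mat_range)
  ultimately have "(y - ?P *v y) \<bullet> (y - ?P *v y) = 0"
    by (simp add: inner_diff_right)
  then have "y = ?P *v y"
    by simp
  then show "y \<in> mat_range B"
    using orth_proj_in[OF csubspace_mat_range, of B y] by simp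
qed

text \<open>
  A positive semidefinite matrix is bounded below by a multiple of its range projection:
  it is injective, hence bounded below in norm, on its range, and \<open>psd_norm_square_le\<close> turns
  this into a bound for the form.
\<close>
lemma psd_ge_range_projection:
  fixes A :: "complex^'n^'n"
  assumes "psd A"
  obtains c where "c > 0" "\<And>x. c * (norm (orth_proj (mat_range A) *v x))\<^sup>2 \<le> (A *v x) \<bullet> x"
proof -
  let ?R = "mat_range A" let ?P = "orth_proj ?R"
  have R: "subspace ?R"
    by (intro csubspace_imp_subspace csubspace_mat_range)
  have "x = 0" if "x \<in> ?R" "A *v x = 0" for x
    using that perp_mat_range_iff[OF assms, of x] by (metis inner_eq_zero_iff)
  then obtain e where e: "e > 0" "\<And>x. x \<in> ?R \<Longrightarrow> e * norm x \<le> norm (A *v x)"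
    using injective_imp_isometric[OF closed_subspace[OF R] R matrix_vector_mul_bounded_linear, of A]
    by blast
  obtain K where K: "K > 0" "\<And>x. (norm (A *v x))\<^sup>2 \<le> K * ((A *v x) \<bullet> x)"
    using psd_norm_square_le[OF assms] by blast
  have "e\<^sup>2 / K * (norm (?P *v x))\<^sup>2 \<le> (A *v x) \<bullet> x" for x
  proof -
    have "e * norm (?P *v x) \<le> norm (A *v x)"
      using e(2)[OF orth_proj_in[OF csubspace_mat_range], of x]
      by (simp add: mult_orth_proj_mat_range[OF assms])
    then have "(e * norm (?P *v x))\<^sup>2 \<le> (norm (A *v x))\<^sup>2"
      using e(1) by (intro power_mono) simp_all
    also have "\<dots> \<le> K * ((A *v x) \<bullet> x)"
      by (rule K)
    finally show ?thesis
      using K(1) by (simp add: field_simps power_mult_distrib)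
  qed
  then show ?thesis
    using e(1) K(1) by (intro that[of "e\<^sup>2 / K"]) simp_all
qed

section \<open>Eigenvector estimates\<close>

text \<open>
  With \<open>t = s / b\<close> this is \<open>s * ((1 - t) * t powr (q - 1)) \<le> s / (q - 1)\<close>, which follows from
  \<open>t powr r \<le> exp (- r * (1 - t)) \<le> 1 / (r * (1 - t))\<close> with \<open>r = q - 1\<close>.
\<close>
lemma powr_gap:
  fixes s b q :: real
  assumes "0 \<le> s" "s < b" "1 < q"
  shows "(b - s) * (s / b) powr q \<le> s / (q - 1)"
proof (cases "s = 0")
  case False
  define t r where "t = s / b" and "r = q - 1"
  have t: "0 < t" "t < 1" and r: "0 < r" and b: "0 < b" and s: "0 < s"
    using assms False by (simp_all add: t_def r_def)
  have "t powr r = exp (r * ln t)"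
    using t by (simp add: powr_def)
  also have "\<dots> \<le> exp (r * (t - 1))"
    using t r by (simp add: ln_le_minus_one)
  also have "\<dots> = 1 / exp (r * (1 - t))"
    by (simp add: exp_minus' [symmetric] algebra_simps)
  also have "\<dots> \<le> 1 / (r * (1 - t))"
  proof (rule divide_left_mono)
    show "r * (1 - t) \<le> exp (r * (1 - t))"
      using exp_ge_add_one_self[of "r * (1 - t)"] by linarith
  qed (use t r in simp_all)
  finally have "(1 - t) * t powr r \<le> 1 / r"
    using t r by (simp add: field_simps)
  then have "s * ((1 - t) * t powr r) \<le> s * (1 / r)"
    using s by (intro mult_left_mono) simp_all
  moreover have "(b - s) * t powr q = s * ((1 - t) * t powr r)"
  proof -
    have "t powr q = t * t powr r"
      using t powr_add[of t 1 r] by (simp add: r_def)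
    moreover have "(b - s) * t = s * (1 - t)"
      using b by (simp add: t_def field_simps)
    ultimately show ?thesis
      by (simp add: mult_ac)
  qed
  ultimately show ?thesis
    by (simp add: t_def r_def)
qed simp

text \<open>
  If the eigenvalue is smaller than \<open>a powr p\<close>, the lower bound on the form makes the component
  in \<open>M\<close> small; if it is larger, the upper bound on \<open>M\<close> does, through Cauchy-Schwarz for the form
  of \<open>B\<close>. In both cases the component is at most a constant times \<open>t powr (p / 2)\<close>, where \<open>t < 1\<close>
  is the ratio of the smaller to the larger of \<open>\<mu>\<close> and \<open>a\<close>; multiplied by \<open>\<bar>\<mu> - a\<bar>\<close> this is
  \<open>O(1 / p)\<close> uniformly in \<open>\<mu>\<close>.
\<close>
lemma eigenvector_component_bound:
  fixes B :: "complex^'n^'n"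
  assumes B: "psd B" and M: "vec.subspace M"
    and ev: "B *v v = (\<mu> powr p) *\<^sub>R v" and \<mu>: "0 \<le> \<mu>"
    and a: "0 < a" and p: "2 < p" and K: "1 \<le> K"
    and lower: "a powr p * (norm (orth_proj M *v v))\<^sup>2 \<le> K * ((B *v v) \<bullet> v)"
    and upper: "\<And>w. w \<in> M \<Longrightarrow> (B *v w) \<bullet> w \<le> K * a powr p * (norm w)\<^sup>2"
  shows "\<bar>\<mu> - a\<bar> * norm (orth_proj M *v v) \<le> K * a / (p / 2 - 1) * norm v"
proof -
  define w where "w = orth_proj M *v v"
  have q: "1 < p / 2"
    using p by simp
  have sq: "(x powr (p / 2))\<^sup>2 = x powr p" for x :: real
    by (simp add: power2_eq_square flip: powr_add)
  have decay: "norm w \<le> K * x powr (p / 2) * norm v"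
    if "(norm w)\<^sup>2 \<le> K * x powr p * (norm v)\<^sup>2" for x
  proof (rule power2_le_imp_le)
    have "K * (x powr p * (norm v)\<^sup>2) \<le> K\<^sup>2 * (x powr p * (norm v)\<^sup>2)"
      using K by (intro mult_right_mono) (simp_all add: power2_eq_square)
    with that show "(norm w)\<^sup>2 \<le> (K * x powr (p / 2) * norm v)\<^sup>2"
      by (simp add: power_mult_distrib sq mult.assoc)
  qed (use K in simp)
  have vv: "(B *v v) \<bullet> v = \<mu> powr p * (norm v)\<^sup>2"
    by (simp add: ev dot_square_norm)
  consider "\<mu> = a" | "\<mu> < a" | "a < \<mu>"
    by linarith
  then have "\<bar>\<mu> - a\<bar> * norm w \<le> K * a / (p / 2 - 1) * norm v"
  proof cases
    case 1
    then show ?thesis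
      using a K q by simp
  next
    case 2
    have "(norm w)\<^sup>2 \<le> K * (\<mu> / a) powr p * (norm v)\<^sup>2"
      using lower a \<mu> by (simp add: vv w_def[symmetric] powr_divide field_simps)
    then have "\<bar>\<mu> - a\<bar> * norm w \<le> (a - \<mu>) * (K * (\<mu> / a) powr (p / 2) * norm v)"
      using 2 by (simp add: decay mult_left_mono)
    also have "\<dots> = K * ((a - \<mu>) * (\<mu> / a) powr (p / 2)) * norm v"
      by simp
    also have "\<dots> \<le> K * (\<mu> / (p / 2 - 1)) * norm v"
      using K by (intro mult_right_mono mult_left_mono powr_gap \<mu> 2 q) simp_all
    also have "\<dots> \<le> K * (a / (p / 2 - 1)) * norm v"
      using K 2 q by (intro mult_right_mono mult_left_mono divide_right_mono) simp_all
    finally show ?thesis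
      by simp
  next
    case 3
    have wM: "w \<in> M"
      unfolding w_def by (rule orth_proj_in[OF M])
    have "\<mu> powr p * (norm w)\<^sup>2 \<le> K * a powr p * (norm v)\<^sup>2"
    proof (cases "w = 0")
      case False
      have "(B *v v) \<bullet> w = \<mu> powr p * (norm w)\<^sup>2"
        by (simp add: ev w_def orth_proj_inner_self[OF M])
      then have "(\<mu> powr p * (norm w)\<^sup>2)\<^sup>2 \<le> (\<mu> powr p * (norm v)\<^sup>2) * ((B *v w) \<bullet> w)"
        using Cauchy_Schwarz_psd[OF B, of v w] by (simp add: vv)
      also have "\<dots> \<le> (\<mu> powr p * (norm v)\<^sup>2) * (K * a powr p * (norm w)\<^sup>2)"
        by (intro mult_left_mono upper wM) simp
      finally have "(\<mu> powr p * (norm w)\<^sup>2) * (\<mu> powr p * (norm w)\<^sup>2)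
          \<le> (K * a powr p * (norm v)\<^sup>2) * (\<mu> powr p * (norm w)\<^sup>2)"
        by (simp add: power2_eq_square mult_ac)
      then show ?thesis
        by (rule mult_right_le_imp_le) (use False a 3 in simp)
    qed (use K in simp)
    then have "(norm w)\<^sup>2 \<le> K * (a / \<mu>) powr p * (norm v)\<^sup>2"
      using a 3 by (simp add: powr_divide field_simps)
    then have "\<bar>\<mu> - a\<bar> * norm w \<le> (\<mu> - a) * (K * (a / \<mu>) powr (p / 2) * norm v)"
      using 3 by (simp add: decay mult_left_mono)
    also have "\<dots> = K * ((\<mu> - a) * (a / \<mu>) powr (p / 2)) * norm v"
      by simp
    also have "\<dots> \<le> K * (a / (p / 2 - 1)) * norm v"
      using K a 3 by (intro mult_right_mono mult_left_mono powr_gap q) simp_all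
    finally show ?thesis
      by simp
  qed
  then show ?thesis
    by (simp add: w_def)
qed

section \<open>The limit of roots of power sums\<close>

text \<open>
  \<open>M k\<close> collects the directions in which \<open>Q k\<close> is the first to act, so \<open>a k powr p\<close> is the
  dominant coefficient there and survives the \<open>p\<close>-th root. The blocks \<open>M k\<close> and the orthogonal
  complement of \<open>R m\<close> decompose the space; on each eigenvector of the power sum the root and its
  claimed limit differ by \<open>O(1 / p)\<close>, block by block.
\<close>
lemma tendsto_root_of_power_sum:
  fixes Q :: "nat \<Rightarrow> complex^'n^'n" and a :: "nat \<Rightarrow> real"
  assumes Q: "\<And>k. k \<in> {1..m} \<Longrightarrow> psd (Q k)"
    and pos: "\<And>k. k \<in> {1..m} \<Longrightarrow> 0 < a k"
    and dec: "\<And>i j. 1 \<le> i \<Longrightarrow> i < j \<Longrightarrow> j \<le> m \<Longrightarrow> a j < a i"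
  defines "R \<equiv> \<lambda>k. mat_range (\<Sum>j=1..k. Q j)"
  shows "((\<lambda>p. mat_powr (\<Sum>k=1..m. a k powr p *\<^sub>R Q k) (1 / p)) \<longlongrightarrow>
           (\<Sum>k=1..m. a k *\<^sub>R orth_proj (R k \<ominus> R (k - 1)))) at_top"
proof -
  define S where "S k = (\<Sum>j=1..k. Q j)" for k
  define M where "M k = R k \<ominus> R (k - 1)" for k
  define D where "D k = orth_proj (M k)" for k
  define B where "B p = (\<Sum>k=1..m. a k powr p *\<^sub>R Q k)" for p
  have mono: "a j \<le> a i" if "1 \<le> i" "i \<le> j" "j \<le> m" for i j
    using dec[of i j] that by (cases "i = j") auto
  have R: "vec.subspace (R k)" and M: "vec.subspace (M k)" and MR: "M k \<subseteq> R k" for k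
    unfolding M_def R_def
    by (intro csubspace_mat_range csubspace_orth_minus)+ (simp add: orth_minus_def)
  have psdS: "psd (S k)" if "k \<le> m" for k
    unfolding S_def using that by (intro psd_sum Q) auto
  have psdB: "psd (B p)" for p
    unfolding B_def by (intro psd_sum psd_scaleR Q) simp_all
  have formS: "(S k *v x) \<bullet> x = (\<Sum>j=1..k. (Q j *v x) \<bullet> x)" for k x
    by (simp add: S_def sum_mult_vec inner_sum_left)
  have formB: "(B p *v x) \<bullet> x = (\<Sum>j=1..m. a j powr p * ((Q j *v x) \<bullet> x))" for p x
    by (simp add: B_def sum_mult_vec scaleR_mult_vec inner_sum_left)
  have Q0: "(Q j *v x) \<bullet> x = 0" if "S k *v x = 0" "k \<le> m" "1 \<le> j" "j \<le> k" for k j x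
  proof -
    have "(\<Sum>j=1..k. (Q j *v x) \<bullet> x) = 0"
      using that(1) formS[of k x] by simp
    then show ?thesis
      using that Q by (subst (asm) sum_nonneg_eq_0_iff) (auto intro: psd_nonneg)
  qed
  (* The forms increase with k, so the kernels decrease and the ranges increase. *)
  have Rmono: "R (k - 1) \<subseteq> R k" if "1 \<le> k" "k \<le> m" for k
    unfolding R_def S_def[symmetric]
  proof (rule mat_range_mono_of_kernel[OF psdS psdS])
    fix x assume "S k *v x = 0"
    then have "(S (k - 1) *v x) \<bullet> x = 0"
      using that Q0[of k x] unfolding formS by (intro sum.neutral) auto
    then show "S (k - 1) *v x = 0"
      using that by (intro psd_kernel psdS) simp_all
  qed (use that in simp_all)
  have R0: "R 0 = {0}"
    by (simp add: R_def mat_range_def image_constant_conv)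
  have resolution: "orth_proj (R k) = (\<Sum>j=1..k. D j)" if "k \<le> m" for k
    using that
  proof (induction k)
    case 0
    then show ?case
      using orth_proj_in[OF vec.subspace_single_0] by (auto simp: matrix_eq R0)
  next
    case (Suc k)
    then show ?case
      using orth_proj_split[OF R R Rmono[of "Suc k"]] by (simp add: D_def M_def)
  qed
  (* Up to a constant K independent of p, the form of B p dominates a k powr p times the squared
     norm of the M k component of any vector, and is dominated by it on M k itself. *)
  have "\<exists>K\<ge>1. \<forall>p\<ge>0. (\<forall>v. a k powr p * (norm (D k *v v))\<^sup>2 \<le> K * ((B p *v v) \<bullet> v)) \<and>
      (\<forall>w\<in>M k. (B p *v w) \<bullet> w \<le> K * a k powr p * (norm w)\<^sup>2)" if k: "1 \<le> k" "k \<le> m" for k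
  proof -
    have ak: "0 < a k"
      using k pos by simp
    obtain c where c: "c > 0"
      "\<And>x. c * (norm (orth_proj (mat_range (S k)) *v x))\<^sup>2 \<le> (S k *v x) \<bullet> x"
      using psd_ge_range_projection[OF psdS[OF k(2)]] by blast
    obtain C where C: "C > 0" "\<And>x. (S m *v x) \<bullet> x \<le> C * (norm x)\<^sup>2"
      by (rule mat_form_bound[of "S m"]) blast
    define K where "K = 1 + 1 / c + C"
    have K: "1 \<le> K" "1 / c \<le> K" "C \<le> K"
      using c(1) C(1) by (simp_all add: K_def)
    (* Only the terms with j <= k are kept; their coefficients are at least a k powr p. *)
    have lower: "a k powr p * (norm (D k *v v))\<^sup>2 \<le> K * ((B p *v v) \<bullet> v)" if p: "0 \<le> p" for p v
    proof -
      have "c * (norm (D k *v v))\<^sup>2 \<le> c * (norm (orth_proj (R k) *v v))\<^sup>2"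
        unfolding D_def using c(1)
        by (intro mult_left_mono power_mono orth_proj_norm_mono R M MR) simp_all
      also have "\<dots> \<le> (S k *v v) \<bullet> v"
        using c(2) by (simp add: R_def S_def)
      finally have "a k powr p * (c * (norm (D k *v v))\<^sup>2) \<le> a k powr p * ((S k *v v) \<bullet> v)"
        by (intro mult_left_mono) simp_all
      also have "\<dots> \<le> (\<Sum>j=1..k. a j powr p * ((Q j *v v) \<bullet> v))"
        unfolding formS sum_distrib_left using k ak p mono Q
        by (intro sum_mono mult_right_mono powr_mono2 psd_nonneg) auto
      also have "\<dots> \<le> (B p *v v) \<bullet> v"
        unfolding formB using k Q by (intro sum_mono2 mult_nonneg_nonneg psd_nonneg) auto
      finally have "a k powr p * (norm (D k *v v))\<^sup>2 \<le> 1 / c * ((B p *v v) \<bullet> v)"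
        using c(1) by (simp add: field_simps)
      also have "\<dots> \<le> K * ((B p *v v) \<bullet> v)"
        by (intro mult_right_mono K psd_nonneg psdB)
      finally show ?thesis .
    qed
    (* M k is orthogonal to R (k - 1), so on it the terms with j < k vanish, and the remaining
       coefficients are at most a k powr p. *)
    have upper: "(B p *v w) \<bullet> w \<le> K * a k powr p * (norm w)\<^sup>2" if p: "0 \<le> p" and w: "w \<in> M k" for p w
    proof -
      have "\<forall>y\<in>R (k - 1). w \<bullet> y = 0"
        using w by (simp add: M_def orth_minus_eq[OF R])
      then have "S (k - 1) *v w = 0"
        unfolding R_def S_def[symmetric] using k perp_mat_range_iff[OF psdS] by simp
      then have below: "(Q j *v w) \<bullet> w = 0" if "1 \<le> j" "j < k" for j
        using Q0[of "k - 1" w j] that k by simp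
      have "a j powr p * ((Q j *v w) \<bullet> w) \<le> a k powr p * ((Q j *v w) \<bullet> w)"
        if j: "j \<in> {1..m}" for j
      proof (cases "j < k")
        case False
        then show ?thesis
          using j k p mono[of k j] pos[OF j] Q
          by (intro mult_right_mono powr_mono2 psd_nonneg) auto
      qed (use j below in simp)
      then have "(B p *v w) \<bullet> w \<le> a k powr p * ((S m *v w) \<bullet> w)"
        unfolding formB formS sum_distrib_left by (rule sum_mono)
      also have "\<dots> \<le> a k powr p * (K * (norm w)\<^sup>2)"
      proof (rule mult_left_mono)
        have "C * (norm w)\<^sup>2 \<le> K * (norm w)\<^sup>2"
          using K(3) by (rule mult_right_mono) simp
        then show "(S m *v w) \<bullet> w \<le> K * (norm w)\<^sup>2"
          using C(2)[of w] by linarith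
      qed simp
      finally show ?thesis
        by (simp add: mult_ac)
    qed
    show ?thesis
      using K(1) lower upper by blast
  qed
  then obtain K where K: "\<And>k. 1 \<le> k \<Longrightarrow> k \<le> m \<Longrightarrow> 1 \<le> K k"
    and lower: "\<And>k p v. 1 \<le> k \<Longrightarrow> k \<le> m \<Longrightarrow> 0 \<le> p \<Longrightarrow>
        a k powr p * (norm (D k *v v))\<^sup>2 \<le> K k * ((B p *v v) \<bullet> v)"
    and upper: "\<And>k p w. 1 \<le> k \<Longrightarrow> k \<le> m \<Longrightarrow> 0 \<le> p \<Longrightarrow> w \<in> M k \<Longrightarrow>
        (B p *v w) \<bullet> w \<le> K k * a k powr p * (norm w)\<^sup>2"
    by metis
  define G where "G = (\<Sum>k=1..m. a k *\<^sub>R D k)"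
  define L where "L = (\<Sum>k=1..m. K k * a k)"
  have L: "0 \<le> L"
    unfolding L_def
  proof (rule sum_nonneg)
    fix k assume "k \<in> {1..m}"
    then show "0 \<le> K k * a k"
      using K[of k] pos[of k] by simp
  qed
  have eigen: "norm ((mat_powr (B p) (1 / p) - G) *v v) \<le> L / (p / 2 - 1) * norm v"
    if p: "2 < p" and c: "0 \<le> c" and ev: "B p *v v = c *\<^sub>R v" for p c v
  proof -
    define \<mu> where "\<mu> = c powr (1 / p)"
    have \<mu>: "0 \<le> \<mu>" "\<mu> powr p = c"
      using c p by (simp_all add: \<mu>_def powr_powr)
    have root: "mat_powr (B p) (1 / p) *v v = \<mu> *\<^sub>R v"
      unfolding mat_powr_def \<mu>_def using ev psd_sym[OF psdB]
      by (intro fun_calc_eigenvector) (auto simp: mem_eigenspace)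
    (* The component of v outside R m is killed by B p, so it vanishes unless v itself lies
       in the kernel, where the eigenvalue is 0; it never contributes to the root. *)
    define u where "u = v - orth_proj (R m) *v v"
    have "\<forall>y\<in>R m. u \<bullet> y = 0"
      unfolding u_def by (blast intro: orth_proj_perp[OF R])
    then have "S m *v u = 0"
      unfolding R_def S_def[symmetric] using perp_mat_range_iff[OF psdS] by simp
    then have "(B p *v u) \<bullet> u = 0"
      unfolding formB using Q0[of m u] by (intro sum.neutral) auto
    then have "B p *v u = 0"
      by (rule psd_kernel[OF psdB])
    then have "c * (v \<bullet> u) = 0"
      using psd_sym[OF psdB, of p v u] by (simp add: ev)
    moreover have "v \<bullet> u = u \<bullet> u"
      using orth_proj_perp[OF R orth_proj_in[OF R], of v m v]
      by (simp add: u_def inner_diff_left inner_diff_right inner_commute)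
    ultimately have u0: "\<mu> *\<^sub>R u = 0"
      by (auto simp: \<mu>_def)
    have v: "v = u + (\<Sum>k=1..m. D k *v v)"
      by (simp add: u_def resolution sum_mult_vec)
    have "(mat_powr (B p) (1 / p) - G) *v v = \<mu> *\<^sub>R v - (\<Sum>k=1..m. a k *\<^sub>R (D k *v v))"
      by (simp add: matrix_vector_mult_diff_rdistrib root G_def sum_mult_vec scaleR_mult_vec)
    also have "\<mu> *\<^sub>R v = (\<Sum>k=1..m. \<mu> *\<^sub>R (D k *v v))"
      by (subst v) (simp add: scaleR_add_right u0 scaleR_sum_right)
    finally have "norm ((mat_powr (B p) (1 / p) - G) *v v)
        = norm (\<Sum>k=1..m. (\<mu> - a k) *\<^sub>R (D k *v v))"
      by (simp add: sum_subtractf scaleR_diff_left)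
    also have "\<dots> \<le> (\<Sum>k=1..m. K k * a k / (p / 2 - 1) * norm v)"
    proof (rule sum_norm_le)
      fix k assume k: "k \<in> {1..m}"
      then have "\<bar>\<mu> - a k\<bar> * norm (orth_proj (M k) *v v) \<le> K k * a k / (p / 2 - 1) * norm v"
        using p pos \<mu> ev K lower[of k p v] upper[of k p]
        by (intro eigenvector_component_bound[OF psdB[of p] M]) (simp_all add: D_def)
      then show "norm ((\<mu> - a k) *\<^sub>R (D k *v v)) \<le> K k * a k / (p / 2 - 1) * norm v"
        by (simp add: D_def)
    qed
    also have "\<dots> = L / (p / 2 - 1) * norm v"
      by (simp add: L_def sum_divide_distrib sum_distrib_right)
    finally show ?thesis .
  qed
  have "((\<lambda>p. mat_powr (B p) (1 / p)) \<longlongrightarrow> G) at_top"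
  proof (rule matrix_tendstoI)
    fix x :: "complex^'n"
    have "((\<lambda>p. DIM(complex^'n) * (L / (p / 2 - 1)) * norm x) \<longlongrightarrow> 0) at_top"
      by real_asymp
    moreover have "\<forall>\<^sub>F p in at_top. norm (mat_powr (B p) (1 / p) *v x - G *v x)
        \<le> DIM(complex^'n) * (L / (p / 2 - 1)) * norm x"
      using eventually_gt_at_top[of 2]
    proof eventually_elim
      case (elim p)
      then have "0 \<le> L / (p / 2 - 1)"
        using L by simp
      from norm_le_of_eigenvectors[OF psdB this eigen[OF elim]]
      show ?case
        by (simp add: matrix_vector_mult_diff_rdistrib)
    qed
    ultimately have "((\<lambda>p. mat_powr (B p) (1 / p) *v x - G *v x) \<longlongrightarrow> 0) at_top"
      by (rule Lim_null_comparison[rotated])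
    then show "((\<lambda>p. mat_powr (B p) (1 / p) *v x) \<longlongrightarrow> G *v x) at_top"
      by (rule LIM_zero_cancel)
  qed
  then show ?thesis
    by (simp add: B_def G_def D_def M_def)
qed

section \<open>Positive linear maps\<close>

lemma scaleR_eq_mscale: "r *\<^sub>R X = mscale (complex_of_real r) X"
  by (simp add: mscale_def map_matrix_def vec_eq_iff complex_eq_iff)

theorem theorem2p6:
  fixes \<Phi> :: "complex^'n^'n \<Rightarrow> complex^'k^'k"
    and A :: "complex^'n^'n"
    and m :: nat
    and a :: "nat \<Rightarrow> real"
    and P :: "nat \<Rightarrow> complex^'n^'n"
    and M :: "nat \<Rightarrow> (complex^'k) set"
  assumes "positive_linear_map \<Phi>"
    and "psd A"
    and "\<And>i j. 1 \<le> i \<Longrightarrow> i < j \<Longrightarrow> j \<le> m \<Longrightarrow> a j < a i"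
    and "a ` {1..m} = {c \<in> eigenvalues A. 0 < c}"
    and "\<And>k. 1 \<le> k \<Longrightarrow> k \<le> m \<Longrightarrow> P k = orth_proj (eigenspace A (a k))"
    and "A = (\<Sum>k=1..m. a k *\<^sub>R P k)"
    and "M 1 = mat_range (\<Phi> (P 1))"
    and "\<And>k. 2 \<le> k \<Longrightarrow> k \<le> m \<Longrightarrow>
           M k = mat_range (\<Phi> (\<Sum>j=1..k. P j)) \<ominus> mat_range (\<Phi> (\<Sum>j=1..k-1. P j))"
  shows "((\<lambda>p::real. mat_powr (\<Phi> (mat_powr A p)) (1 / p))
           \<longlongrightarrow> (\<Sum>k=1..m. a k *\<^sub>R orth_proj (M k))) at_top"
proof -
  interpret \<Phi>: Vector_Spaces.linear mscale mscale \<Phi>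
    using assms(1) by (simp add: positive_linear_map_def)
  define R where "R k = mat_range (\<Sum>j=1..k. \<Phi> (P j))" for k
  have inj: "inj_on a {1..m}"
  proof (rule linorder_inj_onI)
    fix i j assume "i < j" "i \<in> {1..m}" "j \<in> {1..m}"
    then have "a j < a i"
      by (intro assms(3)) auto
    then show "a i \<noteq> a j"
      by simp
  qed linarith
  have pos: "0 < a k" if "k \<in> {1..m}" for k
    using that assms(4) by blast
  have "mat_powr A p = (\<Sum>k=1..m. a k powr p *\<^sub>R P k)" for p
  proof -
    have "mat_powr A p
        = (\<Sum>c\<in>{c \<in> eigenvalues A. 0 < c}. c powr p *\<^sub>R orth_proj (eigenspace A c))"
      unfolding mat_powr_def fun_calc_def
      using finite_eigenvalues[OF psd_sym[OF assms(2)]] psd_eigenvalue_nonneg[OF assms(2)]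
      by (intro sum.mono_neutral_right) force+
    also have "\<dots> = (\<Sum>k=1..m. a k powr p *\<^sub>R P k)"
      unfolding assms(4)[symmetric] using inj assms(5) by (simp add: sum.reindex)
    finally show ?thesis .
  qed
  then have powers: "\<Phi> (mat_powr A p) = (\<Sum>k=1..m. a k powr p *\<^sub>R \<Phi> (P k))" for p
    by (simp add: \<Phi>.sum \<Phi>.scale scaleR_eq_mscale)
  have psdQ: "psd (\<Phi> (P k))" if "k \<in> {1..m}" for k
    using that assms(1,5) by (simp add: positive_linear_map_def psd_orth_proj csubspace_eigenspace)
  have "M k = R k \<ominus> R (k - 1)" if "k \<in> {1..m}" for k
  proof (cases "k = 1")
    case True
    (* The empty sum has range {0}, so M 1 = R 1 fits the pattern of the other blocks. *)
    have "R 0 = {0}"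
      by (simp add: R_def mat_range_def image_constant_conv)
    then show ?thesis
      using True assms(7) by (simp add: R_def orth_minus_eq vec.subspace_single_0)
  next
    case False
    then show ?thesis
      using that assms(8)[of k] by (simp add: R_def \<Phi>.sum)
  qed
  then show ?thesis
    using tendsto_root_of_power_sum[of m "\<lambda>k. \<Phi> (P k)" a, OF psdQ pos assms(3)]
    by (simp add: powers R_def)
qed

end
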